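(* Let $a>0$ and $n,m\in\mathbb{N}$. Then, as an identity of polynomials in $x$, $$C_{n+m}(x;a)=\sum_{k=0}^{\min(n,m)}\frac{(-n)_k(-m)_k(-x)_k}{k!}\,\left(-a^2\right)^{-k}\,C_{n-k}(x-k;a)\,C_{m-k}(x-k;a).$$
   Context: $\mathbb N=\{0,1,2,\dots\}$, and $(y)_k=y(y+1)\cdots(y+k-1)$ with $(y)_0=1$. The Charlier polynomials are $$C_n(x;a)={}_2F_0\left(-n,-x;-;-\frac1a\right)=\sum_{j=0}^n\frac{(-n)_j(-x)_j}{j!}\left(-\frac1a\right)^j,$$ polynomials of degree $n$ in $x$.
   Formalization: The factor (-a^2)^{-k} is replaced by (a^2)^{-k}, because the printed identity fails for n = m = 1 and every a > 0: its two sides differ by 2x/a^2. *)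

theory Defs
  imports Complex_Main "HOL-Computational_Algebra.Polynomial"
begin

definition charlier :: "nat \<Rightarrow> real \<Rightarrow> real poly" where
  "charlier n a =
     (\<Sum>j = 0..n. smult (pochhammer (- real n) j / fact j * (- (1 / a)) ^ j)
                      (pochhammer (- [:0, 1:]) j))"

lemma poly_charlier:
  "poly (charlier n a) x =
     (\<Sum>j = 0..n. pochhammer (- real n) j * pochhammer (- x) j / fact j * (- (1 / a)) ^ j)"
proof -
  have "poly (pochhammer (- [:0, 1:]) j) x = pochhammer (- x) j" for j
    by (induction j) (simp_all add: pochhammer_Suc)
  then show ?thesis
    by (simp add: charlier_def poly_sum mult_ac)
qed

(* The factor in the identity for C_(n+m) must be (a^2)^(-k), not (-a^2)^(-k): expanding (1 - (s+t)/a)^x = ((1 - s/a) (1 - t/a) - s t / a^2)^x in the generating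
   function e^(s+t) (1 - (s+t)/a)^x yields (a^2)^(-k). With the other sign the identity
   fails for n = m = 1 and every a > 0: *)
lemma minus_sign_fails:
  assumes "a > 0"
  shows "charlier (1 + 1) a \<noteq>
    (\<Sum>k = 0..min 1 1.
       smult (pochhammer (- real 1) k * pochhammer (- real 1) k / fact k
                * (- (a\<^sup>2)) powi (- int k))
             (pochhammer (- [:0, 1:]) k
                * pcompose (charlier (1 - k) a) [:- real k, 1:]
                * pcompose (charlier (1 - k) a) [:- real k, 1:]))"
    (is "?L \<noteq> ?R")
proof
  assume "?L = ?R"
  then have "poly ?L 1 = poly ?R 1"
    by (rule arg_cong)
  also have "poly ?R 1 = (1 - 1 / a)\<^sup>2 + 1 / a\<^sup>2"
    using assms
    by (simp add: poly_pcompose poly_charlier poly_sum pochhammer_Suc power_int_minus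
        power2_eq_square field_simps)
  finally have "poly ?L 1 = (1 - 1 / a)\<^sup>2 + 1 / a\<^sup>2" .
  moreover have "poly ?L 1 = 1 - 2 / a"
    using assms
    by (simp add: poly_charlier numeral_2_eq_2 pochhammer_Suc field_simps)
  ultimately have "1 - 2 / a = (1 - 1 / a)\<^sup>2 + 1 / a\<^sup>2"
    by (rule trans[OF sym, rotated])
  then show False
    using assms by (simp add: power2_eq_square field_simps)
qed

end

theory Submission
  imports Defs
begin

text \<open>
  Both sides are polynomials in \<open>x\<close>, so it suffices to compare them at the natural numbers
  \<open>x = N\<close>. There the Charlier polynomial has an operator description: with
  \<open>T = 1 - D / a\<close>, where \<open>D\<close> is differentiation with respect to an auxiliary variable \<open>u\<close>,
  \<open>C\<^sub>n(N; a)\<close> is the value at \<open>u = 1\<close> of \<open>T\<^sup>N u\<^sup>n\<close>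
  (lemma \<open>poly_diff_op_monom\<close>); this is the exponential generating function
  \<open>e\<^sup>s (1 - s/a)\<^sup>N\<close>, which is the value of \<open>T\<^sup>N e\<^sup>s\<^sup>u\<close> at \<open>u = 1\<close>.

  The operator \<open>T\<close> is not multiplicative, but the Leibniz rule gives
  \<open>T (f g) = T f \<sqdot> T g - (1 / a\<^sup>2) f' g'\<close>. Iterating this \<open>N\<close> times, and using that \<open>T\<close> and \<open>D\<close>
  commute, gives a binomial expansion of \<open>T\<^sup>N (f g)\<close> whose \<open>k\<close>-th term is a multiple of
  \<open>T\<^sup>N\<^sup>-\<^sup>k D\<^sup>k f \<sqdot> T\<^sup>N\<^sup>-\<^sup>k D\<^sup>k g\<close> (lemma \<open>diff_op_power_mult\<close>). For \<open>f = u\<^sup>n\<close> and \<open>g = u\<^sup>m\<close>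
  the \<open>k\<close>-th derivatives are multiples of \<open>u\<^sup>n\<^sup>-\<^sup>k\<close> and \<open>u\<^sup>m\<^sup>-\<^sup>k\<close>, and evaluation at \<open>u = 1\<close>
  gives the claimed sum.
\<close>

definition diff_op :: "real \<Rightarrow> real poly \<Rightarrow> real poly" where
  "diff_op c p = p - smult c (pderiv p)"

lemma diff_op_diff: "diff_op c (p - q) = diff_op c p - diff_op c q"
  by (simp add: diff_op_def pderiv_diff smult_diff_right)

lemma diff_op_smult: "diff_op c (smult b p) = smult b (diff_op c p)"
  by (simp add: diff_op_def pderiv_smult smult_diff_right mult.commute)

lemma diff_op_power_diff: "(diff_op c ^^ N) (p - q) = (diff_op c ^^ N) p - (diff_op c ^^ N) q"
  by (induction N) (simp_all add: diff_op_diff)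

lemma diff_op_power_smult: "(diff_op c ^^ N) (smult b p) = smult b ((diff_op c ^^ N) p)"
  by (induction N) (simp_all add: diff_op_smult)

lemma higher_pderiv_diff_op: "(pderiv ^^ k) (diff_op c p) = diff_op c ((pderiv ^^ k) p)"
  by (induction k) (simp_all add: diff_op_def pderiv_diff pderiv_smult)

lemma diff_op_mult:
  "diff_op c (p * q) = diff_op c p * diff_op c q - smult (c\<^sup>2) (pderiv p * pderiv q)"
  by (simp add: diff_op_def pderiv_mult algebra_simps smult_add_right power2_eq_square)

text \<open>
  Pascal's rule, in the form in which it drives the two binomial expansions below: \<open>h i k\<close>
  stands for \<open>i\<close> applications of one operator and \<open>k\<close> of another, commuting one.
\<close>
lemma binomial_sum_Suc:
  fixes h :: "nat \<Rightarrow> nat \<Rightarrow> real poly"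
  shows "(\<Sum>k\<le>Suc N. smult (real (Suc N choose k) * b ^ k) (h (Suc N - k) k)) =
    (\<Sum>k\<le>N. smult (real (N choose k) * b ^ k) (h (Suc (N - k)) k)) +
    smult b (\<Sum>k\<le>N. smult (real (N choose k) * b ^ k) (h (N - k) (Suc k)))"
proof -
  let ?t = "\<lambda>k. smult (real (N choose k) * b ^ k) (h (Suc N - k) k)"
  have "(\<Sum>k\<le>Suc N. smult (real (Suc N choose k) * b ^ k) (h (Suc N - k) k)) =
      h (Suc N) 0 + (\<Sum>k\<le>N. smult (real (Suc N choose Suc k) * b ^ Suc k) (h (N - k) (Suc k)))"
    by (subst sum.atMost_Suc_shift) simp
  also have "\<dots> = (h (Suc N) 0 + (\<Sum>k\<le>N. ?t (Suc k))) +
      (\<Sum>k\<le>N. smult (real (N choose k) * b ^ Suc k) (h (N - k) (Suc k)))"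
    by (simp add: ring_distribs smult_add_left sum.distrib)
  also have "h (Suc N) 0 + (\<Sum>k\<le>N. ?t (Suc k)) = (\<Sum>k\<le>Suc N. ?t k)"
    by (subst sum.atMost_Suc_shift) simp
  also have "\<dots> = (\<Sum>k\<le>N. smult (real (N choose k) * b ^ k) (h (Suc (N - k)) k))"
    by (simp add: Suc_diff_le)
  also have "(\<Sum>k\<le>N. smult (real (N choose k) * b ^ Suc k) (h (N - k) (Suc k))) =
      smult b (\<Sum>k\<le>N. smult (real (N choose k) * b ^ k) (h (N - k) (Suc k)))"
    by (intro poly_eqI) (simp add: coeff_sum sum_distrib_left mult_ac)
  finally show ?thesis .
qed

lemma diff_op_power_expand:
  "(diff_op c ^^ N) p = (\<Sum>k\<le>N. smult (real (N choose k) * (- c) ^ k) ((pderiv ^^ k) p))"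
proof (induction N arbitrary: p)
  case (Suc N)
  have "(diff_op c ^^ Suc N) p = (diff_op c ^^ N) p - smult c ((diff_op c ^^ N) (pderiv p))"
    by (simp only: funpow_Suc_right o_def diff_op_def[of c p] diff_op_power_diff
        diff_op_power_smult)
  also have "\<dots> = (\<Sum>k\<le>Suc N. smult (real (Suc N choose k) * (- c) ^ k) ((pderiv ^^ k) p))"
    unfolding Suc binomial_sum_Suc[where h = "\<lambda>i k. (pderiv ^^ k) p"]
    by (simp add: funpow_swap1)
  finally show ?case .
qed simp

text \<open>
  The analogue of
  \<open>(1 - c (s + t))\<^sup>N = ((1 - c s) (1 - c t) - c\<^sup>2 s t)\<^sup>N\<close>, with \<open>s\<close> and \<open>t\<close> acting as
  differentiation of the first and of the second factor of the product.
\<close>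
lemma diff_op_power_mult:
  "(diff_op c ^^ N) (p * q) =
    (\<Sum>k\<le>N. smult (real (N choose k) * (- c\<^sup>2) ^ k)
       ((diff_op c ^^ (N - k)) ((pderiv ^^ k) p) * (diff_op c ^^ (N - k)) ((pderiv ^^ k) q)))"
proof (induction N arbitrary: p q)
  case (Suc N)
  have "(diff_op c ^^ Suc N) (p * q) =
      (diff_op c ^^ N) (diff_op c p * diff_op c q)
      + smult (- c\<^sup>2) ((diff_op c ^^ N) (pderiv p * pderiv q))"
    by (simp only: funpow_Suc_right o_def diff_op_mult diff_op_power_diff diff_op_power_smult)
      simp
  also have "\<dots> = (\<Sum>k\<le>Suc N. smult (real (Suc N choose k) * (- c\<^sup>2) ^ k)
       ((diff_op c ^^ (Suc N - k)) ((pderiv ^^ k) p)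
        * (diff_op c ^^ (Suc N - k)) ((pderiv ^^ k) q)))"
    unfolding Suc binomial_sum_Suc[where h = "\<lambda>i k. (diff_op c ^^ i) ((pderiv ^^ k) p)
        * (diff_op c ^^ i) ((pderiv ^^ k) q)"]
    by (simp add: funpow_swap1 higher_pderiv_diff_op)
  finally show ?case .
qed simp

lemma higher_pderiv_monom_pochhammer:
  "(pderiv ^^ k) (monom 1 n) = smult ((- 1) ^ k * pochhammer (- real n) k) (monom 1 (n - k))"
proof (induction k)
  case (Suc k)
  show ?case
  proof (cases "k < n")
    case True
    then show ?thesis
      by (simp add: Suc pderiv_smult pderiv_monom smult_monom pochhammer_Suc of_nat_diff
          algebra_simps)
  next
    case False
    then show ?thesis
      by (simp add: Suc pderiv_smult pderiv_monom pochhammer_of_nat_eq_0_lemma)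
  qed
qed simp

lemma real_binomial_pochhammer:
  "real (N choose k) = (- 1) ^ k * pochhammer (- real N) k / fact k"
  by (simp add: binomial_gbinomial gbinomial_pochhammer)

text \<open>
  Expanding \<open>(1 - D / a)\<^sup>N\<close> by the binomial theorem and evaluating the derivatives of \<open>u\<^sup>n\<close> at
  \<open>u = 1\<close> reproduces the defining sum; the signs of the two Pochhammer symbols cancel.
\<close>
lemma poly_diff_op_monom:
  "poly ((diff_op (1 / a) ^^ N) (monom 1 n)) 1 = poly (charlier n a) (real N)"
proof -
  let ?f = "\<lambda>j. pochhammer (- real n) j * pochhammer (- real N) j / fact j * (- (1 / a)) ^ j"
  have sign: "(- 1) ^ j * (- 1) ^ j = (1 :: real)" for j
    by (simp flip: power_mult_distrib)
  have "poly ((diff_op (1 / a) ^^ N) (monom 1 n)) 1 =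
      (\<Sum>j\<le>N. ((- 1) ^ j * (- 1) ^ j) * ?f j)"
    by (simp only: diff_op_power_expand higher_pderiv_monom_pochhammer real_binomial_pochhammer
        poly_sum poly_smult poly_monom power_one mult_1_right) (simp add: mult_ac)
  also have "\<dots> = (\<Sum>j\<le>N. ?f j)"
    by (simp only: sign mult_1_left)
  \<comment> \<open>The summand vanishes beyond either upper limit.\<close>
  also have "\<dots> = (\<Sum>j\<le>max n N. ?f j)"
    by (rule sum.mono_neutral_left) (auto simp: pochhammer_of_nat_eq_0_lemma)
  also have "\<dots> = (\<Sum>j=0..n. ?f j)"
    by (rule sum.mono_neutral_right) (auto simp: pochhammer_of_nat_eq_0_lemma)
  finally show ?thesis
    by (simp add: poly_charlier)
qed

lemma poly_pochhammer: "poly (pochhammer p k) x = pochhammer (poly p x) k"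
  by (induction k) (simp_all add: pochhammer_Suc)

lemma poly_eqI_nat:
  fixes p q :: "real poly"
  assumes "\<And>N. poly p (real N) = poly q (real N)"
  shows "p = q"
proof (rule ccontr)
  assume "p \<noteq> q"
  then have "finite {x. poly (p - q) x = 0}"
    by (intro poly_roots_finite) simp
  moreover have "range real \<subseteq> {x. poly (p - q) x = 0}"
    using assms by auto
  ultimately have "finite (range real)"
    by (rule rev_finite_subset)
  then show False
    using infinite_UNIV_nat finite_imageD inj_on_of_nat by blast
qed

theorem mainTheorem10:
  fixes a :: real and n m :: nat
  assumes "a > 0"
  shows "charlier (n + m) a =
    (\<Sum>k = 0..min n m.
       smult (pochhammer (- real n) k * pochhammer (- real m) k / fact k
                * (a\<^sup>2) powi (- int k))
             (pochhammer (- [:0, 1:]) k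
                * pcompose (charlier (n - k) a) [:- real k, 1:]
                * pcompose (charlier (m - k) a) [:- real k, 1:]))"
proof (rule poly_eqI_nat)
  fix N :: nat
  let ?f = "\<lambda>k. pochhammer (- real n) k * pochhammer (- real m) k / fact k
      * (a\<^sup>2) powi (- int k) * pochhammer (- real N) k
      * poly (charlier (n - k) a) (real N - real k) * poly (charlier (m - k) a) (real N - real k)"
  let ?T = "diff_op (1 / a)"
  have derivs: "poly ((?T ^^ (N - k)) ((pderiv ^^ k) (monom 1 l))) 1 =
      (- 1) ^ k * pochhammer (- real l) k * poly (charlier (l - k) a) (real N - real k)"
    if "k \<le> N" for k l
    using that
    by (simp add: higher_pderiv_monom_pochhammer diff_op_power_smult poly_diff_op_monom of_nat_diff)
  have coeff: "real (N choose k) * (- (1 / a)\<^sup>2) ^ k =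
      pochhammer (- real N) k / fact k * (a\<^sup>2) powi (- int k)" for k
  proof -
    have "(- (1 / a)\<^sup>2) ^ k = (- 1) ^ k * (a\<^sup>2) powi (- int k)"
      by (simp add: power_minus[of "1 / a\<^sup>2"] power_int_minus power_divide inverse_eq_divide)
    then show ?thesis
      by (simp add: real_binomial_pochhammer flip: power_mult_distrib)
  qed
  have "poly (charlier (n + m) a) (real N) = poly ((?T ^^ N) (monom 1 n * monom 1 m)) 1"
    by (simp add: poly_diff_op_monom mult_monom)
  also have "\<dots> = (\<Sum>k\<le>N. ?f k)"
    unfolding diff_op_power_mult poly_sum
    by (intro sum.cong refl) (simp add: derivs coeff flip: power_mult_distrib)
  also have "\<dots> = (\<Sum>k\<le>max N (min n m). ?f k)"
    by (rule sum.mono_neutral_left) (auto simp: pochhammer_of_nat_eq_0_lemma)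
  also have "\<dots> = (\<Sum>k=0..min n m. ?f k)"
    by (rule sum.mono_neutral_right) (auto simp: pochhammer_of_nat_eq_0_lemma min_def split: if_splits)
  finally show "poly (charlier (n + m) a) (real N) = poly (\<Sum>k = 0..min n m.
       smult (pochhammer (- real n) k * pochhammer (- real m) k / fact k
                * (a\<^sup>2) powi (- int k))
             (pochhammer (- [:0, 1:]) k
                * pcompose (charlier (n - k) a) [:- real k, 1:]
                * pcompose (charlier (m - k) a) [:- real k, 1:])) (real N)"
    by (simp add: poly_sum poly_pochhammer poly_pcompose mult_ac)
qed

end
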